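(* Let $\{G_n\}$ and $\{H_n\}$ be two sequences of finite simple graphs with $LEL(G_n)\neq 0$ for all $n$ such that $$\lim_{n\to\infty}\frac{\Delta(G_n,H_n)}{LEL(G_n)}=0 .$$ Then $$\lim_{n\to\infty}\frac{LEL(H_n)}{LEL(G_n)}=1 .$$
   Context: For a finite simple graph $G$ on $N$ vertices with Laplacian matrix $L(G)=D(G)-A(G)$ and Laplacian eigenvalues $\mu_1\ge\cdots\ge\mu_N$, $LEL(G)=\sum_{i=1}^{N-1}\sqrt{\mu_i}$. For two graphs $G,H$ (whose vertex sets need not coincide), $\Delta(G,H)=|E(G)|+|E(H)|-2|E(G)\cap E(H)|$, i.e. the number of edges in the symmetric difference of $E(G)$ and $E(H)$. *)

theory Defs
  imports
    Complex_Main
    "HOL-Library.Multiset"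
    "Jordan_Normal_Form.Char_Poly"
begin

record 'a graph =
  verts :: "'a set"
  edges :: "'a set set"

definition simple_graph :: "'a graph \<Rightarrow> bool" where
  "simple_graph G \<longleftrightarrow>
     finite (verts G) \<and> (\<forall>e \<in> edges G. e \<subseteq> verts G \<and> card e = 2)"

definition degree_in :: "'a graph \<Rightarrow> 'a \<Rightarrow> nat" where
  "degree_in G v = card {e \<in> edges G. v \<in> e}"

(* An arbitrary numbering of the vertices, needed because matrices are indexed by
   numbers. A different choice conjugates the matrices below by a permutation matrix
   and leaves their eigenvalues unchanged. *)
definition vertex_list :: "'a graph \<Rightarrow> 'a list" where
  "vertex_list G = (SOME vs. distinct vs \<and> set vs = verts G)"

lemma vertex_list:
  assumes "simple_graph G"
  shows "distinct (vertex_list G)" "set (vertex_list G) = verts G"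
    "length (vertex_list G) = card (verts G)"
proof -
  have "finite (verts G)"
    using assms by (simp add: simple_graph_def)
  from finite_distinct_list[OF this]
  have "\<exists>vs. distinct vs \<and> set vs = verts G"
    by (simp only: conj_commute)
  then have *: "distinct (vertex_list G) \<and> set (vertex_list G) = verts G"
    unfolding vertex_list_def by (rule someI_ex)
  then show "distinct (vertex_list G)" "set (vertex_list G) = verts G"
    by simp_all
  show "length (vertex_list G) = card (verts G)"
    using distinct_card[of "vertex_list G"] * by simp
qed

definition degree_matrix :: "'a graph \<Rightarrow> real mat" where
  "degree_matrix G = mat (card (verts G)) (card (verts G))
     (\<lambda>(i, j). if i = j then real (degree_in G (vertex_list G ! i)) else 0)"

definition adjacency_matrix :: "'a graph \<Rightarrow> real mat" where
  "adjacency_matrix G = mat (card (verts G)) (card (verts G))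
     (\<lambda>(i, j). if {vertex_list G ! i, vertex_list G ! j} \<in> edges G then 1 else 0)"

definition laplacian :: "'a graph \<Rightarrow> real mat" where
  "laplacian G = degree_matrix G - adjacency_matrix G"

(* The eigenvalues with their multiplicities, in decreasing order: the i-th entry,
   counted from 0, is the eigenvalue mu_(i+1). The Laplacian is real symmetric, so
   its characteristic polynomial splits over the reals and the list has one entry
   for each vertex. *)
definition laplacian_eigenvalues :: "'a graph \<Rightarrow> real list" where
  "laplacian_eigenvalues G =
     rev (sorted_list_of_multiset (proots (char_poly (laplacian G))))"

definition LEL :: "'a graph \<Rightarrow> real" where
  "LEL G = (\<Sum>i < card (verts G) - 1. sqrt (laplacian_eigenvalues G ! i))"

definition edge_diff :: "'a graph \<Rightarrow> 'a graph \<Rightarrow> int" where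
  "edge_diff G H =
     int (card (edges G)) + int (card (edges H)) - 2 * int (card (edges G \<inter> edges H))"

end

theory Submission
  imports Defs "Jordan_Normal_Form.Schur_Decomposition" "Jordan_Normal_Form.Spectral_Radius"
    "HOL-Analysis.L2_Norm"
begin

text \<open>
  On functions on the vertices, the Laplacian is a sum of squares of linear functionals of norm
  \<^term>\<open>sqrt 2\<close>, one for each edge, and LEL is the trace of its square root. This trace is monotone
  (by Jensen), and it is at most the sum of the norms of any family of functionals whose squares
  add up to the form. Passing from G to the union of G and H, and then decomposing the form of the
  union into that of H and the additional edges, gives
  LEL G \<open>\<le>\<close> LEL H \<open>+\<close> \<^term>\<open>sqrt 2\<close> \<open>\<cdot>\<close> |E(G) - E(H)|. By symmetry |LEL H - LEL G| is at most
  \<^term>\<open>sqrt 2\<close> times the number of edges in the symmetric difference.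
\<close>

subsection \<open>Diagonalization of real symmetric matrices\<close>

text \<open>Over the complex numbers an eigenvalue \<open>z\<close> exists. Moving the matrix across
  the Hermitian product multiplies the nonzero square of \<open>v\<close> once by \<open>z\<close>
  and once by \<open>cnj z\<close>, so \<open>z\<close> is real.\<close>

lemma real_symmetric_eigenvector:
  fixes A :: "real mat"
  assumes A: "A \<in> carrier_mat n n" and sym: "A\<^sup>T = A" and n: "n \<noteq> 0"
  obtains e v where "v \<in> carrier_vec n" "v \<noteq> 0\<^sub>v n" "A *\<^sub>v v = e \<cdot>\<^sub>v v"
proof -
  let ?C = "map_mat complex_of_real A"
  have C: "?C \<in> carrier_mat n n" using A by simp
  from spectrum_non_empty[OF C] n obtain z where z: "eigenvalue ?C z"
    by (auto simp: spectrum_def)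
  then obtain v where v: "v \<in> carrier_vec n" "v \<noteq> 0\<^sub>v n" "?C *\<^sub>v v = z \<cdot>\<^sub>v v"
    using C by (auto simp: eigenvalue_def eigenvector_def)
  have conj: "conjugate (?C *\<^sub>v v) = ?C *\<^sub>v conjugate v"
    using A v(1) by (intro eq_vecI) (auto simp: scalar_prod_def)
  have CT: "?C\<^sup>T = ?C"
    by (metis map_mat_transpose sym)
  have "z * (v \<bullet>c v) = (?C *\<^sub>v v) \<bullet>c v"
    using v by simp
  also have "\<dots> = v \<bullet> (?C *\<^sub>v conjugate v)"
    using transpose_vec_mult_scalar[OF C, of v "conjugate v"] v(1) CT
    by (metis carrier_vec_conjugate comm_scalar_prod mult_mat_vec_carrier C
        transpose_vec_mult_scalar)
  also have "\<dots> = cnj z * (v \<bullet>c v)"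
    using v by (simp flip: conj) (simp add: conjugate_smult_vec)
  finally have "z = cnj z" 
    using conjugate_square_eq_0_vec[OF v(1)] v(2) by simp
  then have zr: "z = complex_of_real (Re z)"
    by (metis Reals_cnj_iff complex_is_Real_iff of_real_Re)
  \<comment> \<open>The complex eigenvector is dropped here: \<open>Re z\<close> is a root of the
    real characteristic polynomial, and this yields a real eigenvector.\<close>
  have "poly (map_poly complex_of_real (char_poly A)) z = 0"
    using z eigenvalue_root_char_poly[OF C] of_real_hom.char_poly_hom[OF A, where 'a=complex] by simp
  then have "poly (char_poly A) (Re z) = 0"
    by (subst (asm) zr) (simp add: of_real_hom.poly_map_poly)
  then have "eigenvalue A (Re z)" using eigenvalue_root_char_poly[OF A] by simp
  then show thesis using that A by (auto simp: eigenvalue_def eigenvector_def)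
qed

text \<open>This serves to split off one eigenvector: complete \<open>v\<close> to a basis,
  orthogonalize and then normalize. The factor \<open>c\<close> is the normalization of
  \<open>v\<close>.\<close>

lemma orthogonal_completion:
  fixes v :: "real vec"
  assumes v: "v \<in> carrier_vec n" and v0: "v \<noteq> 0\<^sub>v n"
  obtains W c where "W \<in> carrier_mat n n" "W\<^sup>T * W = 1\<^sub>m n" "col W 0 = c \<cdot>\<^sub>v v"
proof -
  interpret cof_vec_space n "TYPE(real)" .
  define ws where "ws = gram_schmidt n (basis_completion v)"
  note bc = basis_completion[OF v v0]
  from gram_schmidt_result[OF bc(2,4,5) refl, folded ws_def] bc(6)
  have ws: "set ws \<subseteq> carrier_vec n" "corthogonal ws" "length ws = n" by auto
  have "n \<noteq> 0" using v v0 by auto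
  \<comment> \<open>Gram-Schmidt leaves the first vector of the basis unchanged, and the completion
    starts with \<open>v\<close>.\<close>
  then have hd: "ws ! 0 = v"
    using gram_schmidt_hd[OF v, of "tl (basis_completion v)"] bc(6,7) ws(3)
    by (cases "basis_completion v"; cases ws) (auto simp: ws_def)
  define us where "us = map (\<lambda>w. (1 / sqrt (w \<bullet> w)) \<cdot>\<^sub>v w) ws"
  define W where "W = mat_of_cols n us"
  have W: "W \<in> carrier_mat n n" using ws(3) mat_of_cols_carrier(1)[of n us] by (simp add: W_def us_def)
  have wsn: "ws ! i \<in> carrier_vec n" if "i < n" for i using ws that by auto
  have colW: "col W i = (1 / sqrt (ws ! i \<bullet> ws ! i)) \<cdot>\<^sub>v ws ! i" if "i < n" for i
    unfolding W_def using ws that wsn by (subst col_mat_of_cols) (auto simp: us_def)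
  have pos: "ws ! i \<bullet> ws ! i > 0" if "i < n" for i
    using corthogonalD[OF ws(2), of i i] that ws(3) conjugate_square_ge_0_vec[of "ws ! i"]
    by (auto simp: less_le)
  have "W\<^sup>T * W = 1\<^sub>m n"
  proof (rule eq_matI)
    fix i j assume "i < dim_row (1\<^sub>m n :: real mat)" "j < dim_col (1\<^sub>m n :: real mat)"
    then have ij: "i < n" "j < n" by auto
    have "(W\<^sup>T * W) $$ (i, j) = col W i \<bullet> col W j" using ij W by simp
    also have "\<dots> = (ws ! i \<bullet> ws ! j) / (sqrt (ws ! i \<bullet> ws ! i) * sqrt (ws ! j \<bullet> ws ! j))"
      using ij wsn[OF ij(1)] wsn[OF ij(2)] by (simp add: colW scalar_prod_smult_distrib[of _ n]
          smult_scalar_prod_distrib[of _ n])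
    also have "\<dots> = (1\<^sub>m n) $$ (i, j)"
      using corthogonalD[OF ws(2), of i j] ij ws(3) pos[of i] by (cases "i = j") auto
    finally show "(W\<^sup>T * W) $$ (i, j) = (1\<^sub>m n) $$ (i, j)" .
  qed (use W in auto)
  then show thesis using that W colW[of 0] \<open>n \<noteq> 0\<close> hd by auto
qed

text \<open>Deflation: in an orthonormal basis that begins with an eigenvector, the first column is
  \<open>e\<close> followed by zeros, and by symmetry so is the first row. The induction hypothesis
  diagonalizes the remaining block \<open>B3\<close>.\<close>

theorem real_symmetric_diagonalization:
  fixes A :: "real mat"
  assumes "A \<in> carrier_mat n n" and "A\<^sup>T = A"
  shows "\<exists>U d. U \<in> carrier_mat n n \<and> U\<^sup>T * U = 1\<^sub>m n \<and>
    U\<^sup>T * A * U = mat n n (\<lambda>(i, j). if i = j then d i else 0)"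
  using assms
proof (induction n arbitrary: A)
  case 0
  show ?case by (rule exI[of _ "1\<^sub>m 0"]) (use 0 in \<open>auto intro!: eq_matI\<close>)
next
  case (Suc n A)
  let ?m = "Suc n"
  note A = Suc.prems(1)
  obtain e v where v: "v \<in> carrier_vec ?m" "v \<noteq> 0\<^sub>v ?m" "A *\<^sub>v v = e \<cdot>\<^sub>v v"
    using real_symmetric_eigenvector[OF Suc.prems] by blast
  obtain W c where W: "W \<in> carrier_mat ?m ?m" "W\<^sup>T * W = 1\<^sub>m ?m" "col W 0 = c \<cdot>\<^sub>v v"
    using orthogonal_completion[OF v(1,2)] by blast
  define B where "B = W\<^sup>T * A * W"
  have B: "B \<in> carrier_mat ?m ?m" using W A by (auto simp: B_def)
  have BT: "B\<^sup>T = B"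
    using W(1) A Suc.prems(2) 
    by (simp add: B_def transpose_mult[of _ ?m ?m _ ?m] assoc_mult_mat[of _ ?m ?m _ ?m _ ?m])
  have AW0: "A *\<^sub>v col W 0 = e \<cdot>\<^sub>v col W 0"
    using v A by (simp add: W(3) mult_mat_vec[OF A v(1)] smult_smult_assoc mult.commute)
  have B0: "B $$ (i, 0) = (if i = 0 then e else 0)" if i: "i < ?m" for i
  proof -
    have "B $$ (i, 0) = (W\<^sup>T * (A * W)) $$ (i, 0)" using W A by (simp add: B_def)
    also have "\<dots> = col W i \<bullet> (A *\<^sub>v col W 0)" using i W A by (simp add: mult_mat_vec_def)
    also have "\<dots> = e * (W\<^sup>T * W) $$ (i, 0)" using i W(1) by (simp add: AW0)
    finally show ?thesis using i by (simp add: W(2))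
  qed
  have B0': "B $$ (0, i) = (if i = 0 then e else 0)" if i: "i < ?m" for i
    using B0[OF i] BT B i by (metis carrier_matD index_transpose_mat(1) zero_less_Suc)
  define B3 where "B3 = mat n n (\<lambda>(i, j). B $$ (Suc i, Suc j))"
  let ?z1 = "0\<^sub>m 1 n :: real mat" and ?z2 = "0\<^sub>m n 1 :: real mat"
  have Bb: "B = four_block_mat (mat 1 1 (\<lambda>_. e)) ?z1 ?z2 B3"
    using B B0 B0' by (intro eq_matI) (auto simp: B3_def)
  have B3: "B3 \<in> carrier_mat n n" by (simp add: B3_def)
  have "B3\<^sup>T = B3"
  proof (rule eq_matI)
    fix i j assume "i < dim_row B3" "j < dim_col B3"
    then have "i < n" "j < n" by (auto simp: B3_def)
    then show "B3\<^sup>T $$ (i, j) = B3 $$ (i, j)"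
      using arg_cong[OF BT, of "\<lambda>M. M $$ (Suc i, Suc j)"] B by (auto simp: B3_def)
  qed (use B3 in auto)
  then obtain U d where U: "U \<in> carrier_mat n n" "U\<^sup>T * U = 1\<^sub>m n"
    "U\<^sup>T * B3 * U = mat n n (\<lambda>(i, j). if i = j then d i else 0)"
    using Suc.IH[OF B3] by blast
  define V where "V = four_block_mat (1\<^sub>m 1) ?z1 ?z2 U"
  have V: "V \<in> carrier_mat ?m ?m" using U(1) by (auto simp: V_def)
  have VT: "V\<^sup>T = four_block_mat (1\<^sub>m 1) ?z1 ?z2 (U\<^sup>T)"
    using U(1) by (simp add: V_def transpose_four_block_mat[of _ 1 1 _ n _ n])
  have VV: "V\<^sup>T * V = 1\<^sub>m ?m"
  proof -
    have "V\<^sup>T * V = four_block_mat (1\<^sub>m 1) ?z1 ?z2 (1\<^sub>m n)"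
      unfolding VT unfolding V_def
      using U by (subst mult_four_block_mat[of _ 1 1 _ n _ n _ _ 1 _ n]) auto
    also have "\<dots> = 1\<^sub>m ?m" by (intro eq_matI) auto
    finally show ?thesis .
  qed
  have VB: "V\<^sup>T * B * V = four_block_mat (mat 1 1 (\<lambda>_. e)) ?z1 ?z2 (U\<^sup>T * B3 * U)"
  proof -
    have "V\<^sup>T * B = four_block_mat (mat 1 1 (\<lambda>_. e)) ?z1 ?z2 (U\<^sup>T * B3)"
      unfolding VT Bb
      using U(1) B3 by (subst mult_four_block_mat[of _ 1 1 _ n _ n _ _ 1 _ n]) auto
    then show ?thesis unfolding V_def
      using U(1) B3 by (simp, subst mult_four_block_mat[of _ 1 1 _ n _ n _ _ 1 _ n]) auto
  qed
  \<comment> \<open>The eigenvalue split off comes first; those of the smaller block are shifted by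
    one.\<close>
  let ?d = "\<lambda>i. case i of 0 \<Rightarrow> e | Suc k \<Rightarrow> d k"
  have "(W * V)\<^sup>T * (W * V) = V\<^sup>T * (W\<^sup>T * W) * V"
    using W(1) V by (simp add: transpose_mult[of _ ?m ?m _ ?m] assoc_mult_mat[of _ ?m ?m _ ?m _ ?m])
  also have "\<dots> = 1\<^sub>m ?m" using V by (simp add: W(2) VV)
  finally have 1: "(W * V)\<^sup>T * (W * V) = 1\<^sub>m ?m" .
  have "(W * V)\<^sup>T * A * (W * V) = V\<^sup>T * B * V"
    using W(1) V A
    by (simp add: B_def transpose_mult[of _ ?m ?m _ ?m] assoc_mult_mat[of _ ?m ?m _ ?m _ ?m])
  also have "\<dots> = mat ?m ?m (\<lambda>(i, j). if i = j then ?d i else 0)"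
    unfolding VB U(3) by (rule eq_matI) (auto split: nat.splits)
  finally show ?case using 1 W(1) V by (intro exI[of _ "W * V"] exI[of _ ?d]) auto
qed

subsection \<open>The trace of the square root of a quadratic form\<close>

definition inner_on :: "'a set \<Rightarrow> ('a \<Rightarrow> real) \<Rightarrow> ('a \<Rightarrow> real) \<Rightarrow> real" where
  "inner_on V f g = (\<Sum>v\<in>V. f v * g v)"

lemma inner_on_commute: "inner_on V f g = inner_on V g f"
  by (simp add: inner_on_def mult.commute)

lemma inner_on_sum_right: "inner_on V f (\<lambda>v. \<Sum>i\<in>I. g i v) = (\<Sum>i\<in>I. inner_on V f (g i))"
  unfolding inner_on_def sum_distrib_left by (rule sum.swap)

lemma inner_on_scale_right: "inner_on V f (\<lambda>v. c * g v) = c * inner_on V f g"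
  by (simp add: inner_on_def sum_distrib_left ac_simps)

text \<open>A matrix-free spectral decomposition; Parseval's identity stands for the fact that the
  \<open>p i\<close> span. Functions are total but only their values on \<open>V\<close> count, so
  forms on different vertex sets can be compared at the same \<open>f\<close>.\<close>

definition spectral_frame ::
  "'a set \<Rightarrow> nat \<Rightarrow> (nat \<Rightarrow> 'a \<Rightarrow> real) \<Rightarrow> (nat \<Rightarrow> real) \<Rightarrow> (('a \<Rightarrow> real) \<Rightarrow> real) \<Rightarrow> bool" where
  "spectral_frame V n p m Q \<longleftrightarrow> finite V \<and> (\<forall>i<n. 0 \<le> m i) \<and>
     (\<forall>i<n. \<forall>j<n. inner_on V (p i) (p j) = of_bool (i = j)) \<and>
     (\<forall>f. inner_on V f f = (\<Sum>i<n. (inner_on V (p i) f)\<^sup>2)) \<and>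
     (\<forall>f. Q f = (\<Sum>i<n. m i * (inner_on V (p i) f)\<^sup>2))"

lemma spectral_frameD:
  assumes "spectral_frame V n p m Q"
  shows "finite V" "i < n \<Longrightarrow> 0 \<le> m i"
    "i < n \<Longrightarrow> j < n \<Longrightarrow> inner_on V (p i) (p j) = of_bool (i = j)"
    "inner_on V f f = (\<Sum>i<n. (inner_on V (p i) f)\<^sup>2)"
    "Q f = (\<Sum>i<n. m i * (inner_on V (p i) f)\<^sup>2)"
  using assms by (auto simp: spectral_frame_def)

lemma spectral_frame_eigenvalue:
  assumes F: "spectral_frame V n p m Q" and i: "i < n"
  shows "Q (p i) = m i"
proof -
  have "Q (p i) = (\<Sum>j<n. m j * (inner_on V (p j) (p i))\<^sup>2)" by (rule spectral_frameD(5)[OF F])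
  also have "\<dots> = (\<Sum>j<n. if j = i then m j else 0)"
    by (rule sum.cong) (auto simp: spectral_frameD(3)[OF F _ i])
  finally show ?thesis using i by simp
qed

lemma Cauchy_Schwarz_sum:
  fixes a b :: "'b \<Rightarrow> real"
  shows "(\<Sum>i\<in>I. a i * b i) \<le> sqrt (\<Sum>i\<in>I. (a i)\<^sup>2) * sqrt (\<Sum>i\<in>I. (b i)\<^sup>2)"
proof -
  have "(\<Sum>i\<in>I. a i * b i) \<le> (\<Sum>i\<in>I. \<bar>a i\<bar> * \<bar>b i\<bar>)"
    by (rule sum_mono) (metis abs_ge_self abs_mult)
  also have "\<dots> \<le> L2_set a I * L2_set b I" by (rule L2_set_mult_ineq)
  finally show ?thesis by (simp add: L2_set_def)
qed

text \<open>The squared overlaps \<open>c i j\<close> of the two eigenbases have row sums 1 and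
  column sums at most 1. Jensen's inequality for the square root in column \<open>j\<close> gives at
  most \<open>sqrt (Q (r j))\<close>, hence at most \<open>sqrt (R (r j)) = sqrt (s j)\<close>.
  Summing over \<open>j\<close> finishes.\<close>

theorem spectral_frame_trace_sqrt_mono:
  assumes F: "spectral_frame V n p m Q" and G: "spectral_frame W k r s R"
    and VW: "V \<subseteq> W" and le: "\<And>f. Q f \<le> R f"
  shows "(\<Sum>i<n. sqrt (m i)) \<le> (\<Sum>j<k. sqrt (s j))"
proof -
  define c where "c i j = (inner_on V (p i) (r j))\<^sup>2" for i j
  have row: "(\<Sum>j<k. c i j) = 1" if i: "i < n" for i
  proof -
    \<comment> \<open>Extended by zero, \<open>p i\<close> keeps its norm and becomes accessible to
      Parseval on \<open>W\<close>.\<close>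
    define f where "f v = (if v \<in> V then p i v else 0)" for v
    have *: "inner_on W g f = inner_on V g (p i)" for g
      unfolding inner_on_def f_def using VW spectral_frameD(1)[OF G]
      by (intro sum.mono_neutral_cong_right) auto
    have "1 = inner_on V f (p i)"
      using spectral_frameD(3)[OF F i i] by (simp add: inner_on_def f_def)
    also have "\<dots> = (\<Sum>j<k. (inner_on W (r j) f)\<^sup>2)"
      using spectral_frameD(4)[OF G, of f] by (simp add: *)
    finally show ?thesis by (simp add: * c_def inner_on_commute[of V "p i"])
  qed
  have col: "(\<Sum>i<n. c i j) \<le> 1" if j: "j < k" for j
  proof -
    have "(\<Sum>i<n. c i j) = inner_on V (r j) (r j)"
      unfolding c_def by (rule spectral_frameD(4)[OF F, symmetric])
    \<comment> \<open>Restricting \<open>r j\<close> to \<open>V\<close> can only shorten it, so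
      columns have no equality in general.\<close>
    also have "\<dots> \<le> inner_on W (r j) (r j)"
      unfolding inner_on_def using VW spectral_frameD(1)[OF G] by (intro sum_mono2) auto
    finally show ?thesis by (simp add: spectral_frameD(3)[OF G j j])
  qed
  have jensen: "(\<Sum>i<n. sqrt (m i) * c i j) \<le> sqrt (s j)" if j: "j < k" for j
  proof -
    have Q0: "0 \<le> Q (r j)"
      unfolding spectral_frameD(5)[OF F] using spectral_frameD(2)[OF F] by (auto intro!: sum_nonneg)
    \<comment> \<open>Jensen in the form of Cauchy-Schwarz: the weight \<open>c i j\<close> is split
      into two square roots, and a total weight of at most 1 is enough.\<close>
    have "(\<Sum>i<n. sqrt (m i) * c i j) = (\<Sum>i<n. sqrt (c i j) * sqrt (m i * c i j))"
      by (rule sum.cong) (auto simp: c_def real_sqrt_mult, simp add: power2_eq_square)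
    also have "\<dots> \<le> sqrt (\<Sum>i<n. (sqrt (c i j))\<^sup>2) * sqrt (\<Sum>i<n. (sqrt (m i * c i j))\<^sup>2)"
      by (rule Cauchy_Schwarz_sum)
    also have "\<dots> = sqrt (\<Sum>i<n. c i j) * sqrt (Q (r j))"
      unfolding spectral_frameD(5)[OF F] using spectral_frameD(2)[OF F] by (simp add: c_def)
    also have "\<dots> \<le> 1 * sqrt (s j)"
      using Q0 col[OF j] le[of "r j"] spectral_frame_eigenvalue[OF G j]
      by (intro mult_mono) (auto simp: c_def sum_nonneg)
    finally show ?thesis by simp
  qed
  have "(\<Sum>i<n. sqrt (m i)) = (\<Sum>i<n. sqrt (m i) * (\<Sum>j<k. c i j))"
    by (simp add: row)
  also have "\<dots> = (\<Sum>j<k. \<Sum>i<n. sqrt (m i) * c i j)"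
    unfolding sum_distrib_left by (rule sum.swap)
  also have "\<dots> \<le> (\<Sum>j<k. sqrt (s j))" by (rule sum_mono) (simp add: jensen)
  finally show ?thesis .
qed

text \<open>
  Since \<open>x / 0 = 0\<close>, the left-hand side is the inner product of \<open>b\<close> with the square root of the
  pseudo-inverse applied to \<open>b\<close>. Likewise \<open>t\<close> in the proof comes from the pseudo-inverse itself;
  testing the hypothesis on \<open>y\<close>, the pseudo-inverse applied to \<open>b\<close>, gives \<open>t\<^sup>2 \<le> t\<close>.
\<close>

lemma spectral_frame_inverse_sqrt_le:
  assumes F: "spectral_frame V n p m Q" and le: "\<And>f. (inner_on V b f)\<^sup>2 \<le> Q f"
  shows "(\<Sum>i<n. (inner_on V (p i) b)\<^sup>2 / sqrt (m i)) \<le> sqrt (inner_on V b b)"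
proof -
  define c where "c i = inner_on V (p i) b" for i
  define t where "t = (\<Sum>i<n. (c i)\<^sup>2 / m i)"
  define y where "y v = (\<Sum>i<n. c i / m i * p i v)" for v
  have py: "inner_on V (p j) y = c j / m j" if j: "j < n" for j
  proof -
    have "inner_on V (p j) y = (\<Sum>i<n. c i / m i * inner_on V (p j) (p i))"
      unfolding y_def inner_on_sum_right inner_on_scale_right ..
    also have "\<dots> = (\<Sum>i<n. if i = j then c i / m i else 0)"
      by (rule sum.cong) (auto simp: spectral_frameD(3)[OF F j])
    finally show ?thesis using j by simp
  qed
  have "inner_on V b y = (\<Sum>i<n. c i / m i * inner_on V b (p i))"
    unfolding y_def inner_on_sum_right inner_on_scale_right ..
  also have "\<dots> = t" by (simp add: t_def c_def power2_eq_square inner_on_commute)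
  finally have "inner_on V b y = t" .
  moreover have "Q y = t"
    unfolding spectral_frameD(5)[OF F] t_def
    by (rule sum.cong) (auto simp: py power2_eq_square)
  ultimately have "t\<^sup>2 \<le> t" using le[of y] by simp
  have t1: "t \<le> 1"
  proof (rule ccontr)
    assume "\<not> t \<le> 1"
    then have "1 * t < t * t" by (intro mult_strict_right_mono) auto
    with \<open>t\<^sup>2 \<le> t\<close> show False by (simp add: power2_eq_square)
  qed
  \<comment> \<open>With one factor \<open>c i\<close> split off, Cauchy-Schwarz bounds the sum by
    the norm of \<open>b\<close> times \<open>sqrt t\<close>.\<close>
  have "(\<Sum>i<n. (c i)\<^sup>2 / sqrt (m i)) = (\<Sum>i<n. c i * (c i / sqrt (m i)))"
    by (simp add: power2_eq_square)
  also have "\<dots> \<le> sqrt (\<Sum>i<n. (c i)\<^sup>2) * sqrt (\<Sum>i<n. (c i / sqrt (m i))\<^sup>2)"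
    by (rule Cauchy_Schwarz_sum)
  also have "(\<Sum>i<n. (c i / sqrt (m i))\<^sup>2) = t"
    unfolding t_def using spectral_frameD(2)[OF F]
    by (intro sum.cong) (auto simp: power_divide)
  also have "(\<Sum>i<n. (c i)\<^sup>2) = inner_on V b b"
    unfolding c_def by (rule spectral_frameD(4)[OF F, symmetric])
  also have "sqrt (inner_on V b b) * sqrt t \<le> sqrt (inner_on V b b) * 1"
    using t1 by (intro mult_left_mono) (auto simp: inner_on_def sum_nonneg)
  finally show ?thesis by (simp add: c_def)
qed

text \<open>Write \<open>sqrt (m i)\<close> as \<open>Q (p i) / sqrt (m i)\<close>, expand
  \<open>Q\<close> into squares and exchange the sums. The inner sum for each \<open>k\<close> is
  then bounded by \<open>spectral_frame_inverse_sqrt_le\<close>, since a single square is at most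
  \<open>Q\<close>.\<close>

theorem spectral_frame_trace_sqrt_le:
  assumes F: "spectral_frame V n p m Q" and K: "finite K"
    and Q: "\<And>f. Q f = (\<Sum>k\<in>K. (inner_on V (b k) f)\<^sup>2)"
  shows "(\<Sum>i<n. sqrt (m i)) \<le> (\<Sum>k\<in>K. sqrt (inner_on V (b k) (b k)))"
proof -
  have "(\<Sum>i<n. sqrt (m i)) = (\<Sum>i<n. (\<Sum>k\<in>K. (inner_on V (p i) (b k))\<^sup>2 / sqrt (m i)))"
  proof (rule sum.cong)
    fix i assume "i \<in> {..<n}"
    then have i: "i < n" by simp
    \<comment> \<open>This includes \<open>m i = 0\<close>, where both sides are 0.\<close>
    have "sqrt (m i) = m i / sqrt (m i)"
      using spectral_frameD(2)[OF F i] by (simp add: real_div_sqrt)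
    also have "\<dots> = (\<Sum>k\<in>K. (inner_on V (p i) (b k))\<^sup>2) / sqrt (m i)"
      using Q[of "p i"] spectral_frame_eigenvalue[OF F i] by (simp add: inner_on_commute)
    finally show "sqrt (m i) = (\<Sum>k\<in>K. (inner_on V (p i) (b k))\<^sup>2 / sqrt (m i))"
      by (simp add: sum_divide_distrib)
  qed simp
  also have "\<dots> = (\<Sum>k\<in>K. \<Sum>i<n. (inner_on V (p i) (b k))\<^sup>2 / sqrt (m i))" by (rule sum.swap)
  also have "\<dots> \<le> (\<Sum>k\<in>K. sqrt (inner_on V (b k) (b k)))"
  proof (rule sum_mono)
    fix k assume k: "k \<in> K"
    have "(inner_on V (b k) f)\<^sup>2 \<le> Q f" for f
      unfolding Q using K k by (intro member_le_sum) auto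
    then show "(\<Sum>i<n. (inner_on V (p i) (b k))\<^sup>2 / sqrt (m i)) \<le> sqrt (inner_on V (b k) (b k))"
      by (rule spectral_frame_inverse_sqrt_le[OF F])
  qed
  finally show ?thesis .
qed

subsection \<open>The Laplacian as a quadratic form\<close>

text \<open>For an edge \<open>{u, v}\<close> this is \<open>(f u - f v)\<^sup>2\<close>, written so that no orientation has to be chosen.\<close>

definition edge_energy :: "'a set \<Rightarrow> ('a \<Rightarrow> real) \<Rightarrow> real" where
  "edge_energy e f = 2 * (\<Sum>v\<in>e. (f v)\<^sup>2) - (\<Sum>v\<in>e. f v)\<^sup>2"

lemma edge_energy_pair: "u \<noteq> v \<Longrightarrow> edge_energy {u, v} f = (f u - f v)\<^sup>2"
  by (simp add: edge_energy_def power2_eq_square algebra_simps)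

definition dirichlet_form :: "'a graph \<Rightarrow> ('a \<Rightarrow> real) \<Rightarrow> real" where
  "dirichlet_form G f = (\<Sum>e\<in>edges G. edge_energy e f)"

lemma simple_graph_edge:
  assumes "simple_graph G" "e \<in> edges G"
  obtains u v where "e = {u, v}" "u \<noteq> v" "u \<in> verts G" "v \<in> verts G"
  using assms by (auto simp: simple_graph_def card_2_iff)

lemma simple_graph_finite:
  assumes "simple_graph G"
  shows "finite (verts G)" "finite (edges G)"
  using assms finite_subset[of "edges G" "Pow (verts G)"] by (auto simp: simple_graph_def)

lemma edge_energy_nonneg:
  assumes "simple_graph G" "e \<in> edges G"
  shows "0 \<le> edge_energy e f"
  using assms by (auto elim!: simple_graph_edge simp: edge_energy_pair)

lemma dirichlet_form_nonneg: "simple_graph G \<Longrightarrow> 0 \<le> dirichlet_form G f"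
  by (simp add: dirichlet_form_def edge_energy_nonneg sum_nonneg)

text \<open>Indexing by vertices instead of positions removes the arbitrary numbering
  \<open>vertex_list\<close> from the quadratic form.\<close>

definition laplacian_kernel :: "'a graph \<Rightarrow> 'a \<Rightarrow> 'a \<Rightarrow> real" where
  "laplacian_kernel G u v =
     (if u = v then real (degree_in G u) else 0) - (if {u, v} \<in> edges G then 1 else 0)"

lemma laplacian_index:
  assumes "simple_graph G" "i < card (verts G)" "j < card (verts G)"
  shows "laplacian G $$ (i, j) = laplacian_kernel G (vertex_list G ! i) (vertex_list G ! j)"
  using assms vertex_list[OF assms(1)]
  by (auto simp: laplacian_def degree_matrix_def adjacency_matrix_def laplacian_kernel_def
      nth_eq_iff_index_eq)

text \<open>Degrees and adjacency indicators are both sums over edges. After exchanging the sums, an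
  edge with ends \<open>a\<close> and \<open>b\<close> contributes the squares of \<open>f a\<close>
  and \<open>f b\<close> minus twice their product.\<close>

lemma dirichlet_form_kernel:
  assumes G: "simple_graph G"
  shows "(\<Sum>u\<in>verts G. \<Sum>v\<in>verts G. laplacian_kernel G u v * f u * f v) = dirichlet_form G f"
proof -
  let ?V = "verts G" and ?E = "edges G"
  note fin = simple_graph_finite[OF G]
  have ind: "(if {u, v} \<in> ?E then 1 else 0 :: real) = (\<Sum>e\<in>?E. if e = {u, v} then 1 else 0)" for u v
    using fin(2) by simp
  have deg: "real (degree_in G u) = (\<Sum>e\<in>?E. if u \<in> e then 1 else 0)" for u
    using fin(2) by (simp add: degree_in_def sum.If_cases Int_def)
  have "(\<Sum>u\<in>?V. \<Sum>v\<in>?V. laplacian_kernel G u v * f u * f v)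
    = (\<Sum>u\<in>?V. \<Sum>v\<in>?V. (if u = v then real (degree_in G u) * f u * f v else 0))
      - (\<Sum>u\<in>?V. \<Sum>v\<in>?V. (if {u, v} \<in> ?E then 1 else 0) * f u * f v)"
    unfolding sum_subtractf[symmetric]
    by (intro sum.cong) (auto simp: laplacian_kernel_def algebra_simps)
  also have "(\<Sum>u\<in>?V. \<Sum>v\<in>?V. (if u = v then real (degree_in G u) * f u * f v else 0))
    = (\<Sum>u\<in>?V. \<Sum>e\<in>?E. if u \<in> e then (f u)\<^sup>2 else 0)"
    using fin(1) by (intro sum.cong)
      (auto simp: deg sum_distrib_right power2_eq_square if_distrib if_distribR cong: if_cong)
  also have "\<dots> = (\<Sum>e\<in>?E. \<Sum>u\<in>?V. if u \<in> e then (f u)\<^sup>2 else 0)" by (rule sum.swap)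
  also have "(\<Sum>u\<in>?V. \<Sum>v\<in>?V. (if {u, v} \<in> ?E then 1 else 0) * f u * f v)
    = (\<Sum>e\<in>?E. \<Sum>u\<in>?V. \<Sum>v\<in>?V. (if e = {u, v} then 1 else 0) * f u * f v)"
    unfolding ind sum_distrib_right sum.swap[of _ ?E] by (simp add: sum.swap[of _ ?E])
  also have "(\<Sum>e\<in>?E. \<Sum>u\<in>?V. if u \<in> e then (f u)\<^sup>2 else 0) - \<dots>
    = (\<Sum>e\<in>?E. (\<Sum>u\<in>?V. if u \<in> e then (f u)\<^sup>2 else 0) -
        (\<Sum>u\<in>?V. \<Sum>v\<in>?V. (if e = {u, v} then 1 else 0) * f u * f v))"
    by (simp add: sum_subtractf)
  also have "\<dots> = dirichlet_form G f"
    unfolding dirichlet_form_def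
  proof (rule sum.cong)
    fix e assume "e \<in> ?E"
    then obtain a b where e: "e = {a, b}" "a \<noteq> b" "a \<in> ?V" "b \<in> ?V"
      by (rule simple_graph_edge[OF G])
    have "(\<Sum>u\<in>?V. if u \<in> e then (f u)\<^sup>2 else 0) = (\<Sum>u\<in>{a, b}. (f u)\<^sup>2)"
      using e fin(1) by (intro sum.mono_neutral_cong_right) auto
    \<comment> \<open>The unordered edge is met by the two ordered pairs \<open>(a, b)\<close> and
      \<open>(b, a)\<close>, hence two terms.\<close>
    moreover have "(\<Sum>v\<in>?V. (if e = {u, v} then 1 else 0) * f u * f v)
      = (if u = a then f a * f b else 0) + (if u = b then f b * f a else 0)" for u
    proof -
      have "(if e = {u, v} then 1 else 0) * f u * f v
        = (if v = b then if u = a then f a * f b else 0 else 0)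
          + (if v = a then if u = b then f b * f a else 0 else 0)" for v
        using e by (auto simp: doubleton_eq_iff)
      then show ?thesis using e fin(1) by (simp add: sum.distrib)
    qed
    ultimately show "(\<Sum>u\<in>?V. if u \<in> e then (f u)\<^sup>2 else 0) -
        (\<Sum>u\<in>?V. \<Sum>v\<in>?V. (if e = {u, v} then 1 else 0) * f u * f v) = edge_energy e f"
      using e fin(1) by (simp add: edge_energy_pair sum.distrib power2_eq_square algebra_simps)
  qed simp
  finally show ?thesis .
qed

lemma transpose_laplacian: "(laplacian G)\<^sup>T = laplacian G"
  by (rule eq_matI)
    (auto simp: laplacian_def degree_matrix_def adjacency_matrix_def insert_commute)

lemma sum_verts_nth:
  assumes "simple_graph G"
  shows "(\<Sum>v\<in>verts G. g v) = (\<Sum>i<card (verts G). g (vertex_list G ! i))"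
  using bij_betw_nth[OF vertex_list(1)[OF assms] refl refl] vertex_list(2,3)[OF assms]
  by (simp add: sum.reindex_bij_betw)

text \<open>The columns of the diagonalizing matrix, read as functions on the vertices, are the
  frame. The characteristic polynomial is supplied along with it to tie \<open>d\<close> to the
  eigenvalue list in \<open>LEL\<close>.\<close>

theorem laplacian_spectral_frame:
  assumes G: "simple_graph G"
  obtains p d where "spectral_frame (verts G) (card (verts G)) p d (dirichlet_form G)"
    "char_poly (laplacian G) = (\<Prod>a\<leftarrow>map d [0..<card (verts G)]. [:- a, 1:])"
proof -
  define n where "n = card (verts G)"
  define vs where "vs = vertex_list G"
  let ?L = "laplacian G"
  have vs: "distinct vs" "set vs = verts G" "length vs = n"
    unfolding vs_def n_def by (rule vertex_list[OF G])+
  have L: "?L \<in> carrier_mat n n"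
    by (rule carrier_matI)
      (simp_all add: laplacian_def degree_matrix_def adjacency_matrix_def n_def)
  obtain U d where U: "U \<in> carrier_mat n n" and UU: "U\<^sup>T * U = 1\<^sub>m n"
    and D: "U\<^sup>T * ?L * U = mat n n (\<lambda>(i, j). if i = j then d i else 0)"
    using real_symmetric_diagonalization[OF L transpose_laplacian] by blast
  let ?D = "mat n n (\<lambda>(i, j). if i = j then d i else 0)"
  have UU': "U * U\<^sup>T = 1\<^sub>m n"
    using mat_mult_left_right_inverse[OF _ U UU] U by simp
  have LD: "?L = U * ?D * U\<^sup>T"
  proof -
    have "U * ?D * U\<^sup>T = (U * U\<^sup>T) * ?L * (U * U\<^sup>T)"
      unfolding D[symmetric] using U L by (simp add: assoc_mult_mat[of _ n n _ n _ n])
    then show ?thesis using L by (simp add: UU')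
  qed
  define idx where "idx v = (THE i. i < n \<and> vs ! i = v)" for v
  have idx: "idx (vs ! i) = i" if "i < n" for i
    unfolding idx_def using that vs by (intro the_equality) (auto simp: nth_eq_iff_index_eq)
  define p where "p i v = U $$ (idx v, i)" for i v
  define X where "X f = vec n (\<lambda>i. f (vs ! i))" for f :: "'a \<Rightarrow> real"
  have X[simp]: "X f \<in> carrier_vec n" for f by (simp add: X_def)
  have inner_on_X: "inner_on (verts G) f g = X f \<bullet> X g" for f g
    unfolding inner_on_def sum_verts_nth[OF G]
    by (simp add: X_def scalar_prod_def n_def[symmetric] vs_def[symmetric] atLeast0LessThan)
  have Xp: "X (p i) = col U i" if "i < n" for i
    using U that by (intro eq_vecI) (auto simp: X_def p_def idx)
  have inner_on_p: "inner_on (verts G) (p i) f = (U\<^sup>T *\<^sub>v X f) $ i" if "i < n" for i f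
    using U that by (simp add: inner_on_X Xp)
  have form: "dirichlet_form G f = X f \<bullet> (?L *\<^sub>v X f)" for f
    unfolding dirichlet_form_kernel[OF G, symmetric] sum_verts_nth[OF G]
    using L by (simp add: scalar_prod_def X_def laplacian_index[OF G] atLeast0LessThan
        sum_distrib_left n_def[symmetric] vs_def[symmetric] ac_simps)
  have frame: "spectral_frame (verts G) n p d (dirichlet_form G)"
    unfolding spectral_frame_def
  proof (intro conjI allI impI)
    show "finite (verts G)" by (rule simple_graph_finite[OF G])
  next
    fix i j assume "i < n" "j < n"
    moreover from this have "inner_on (verts G) (p i) (p j) = (U\<^sup>T * U) $$ (i, j)"
      using U by (simp add: inner_on_X Xp)
    ultimately show "inner_on (verts G) (p i) (p j) = of_bool (i = j)" by (simp add: UU)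
  next
    fix f
    \<comment> \<open>Orthonormality came from \<open>U\<^sup>T * U\<close>; Parseval's identity
      comes from the opposite product \<open>U * U\<^sup>T\<close>.\<close>
    have "inner_on (verts G) f f = X f \<bullet> (U *\<^sub>v (U\<^sup>T *\<^sub>v X f))"
      using assoc_mult_mat_vec[of U n n "U\<^sup>T" n "X f"] U by (simp add: UU' inner_on_X)
    also have "\<dots> = (U\<^sup>T *\<^sub>v X f) \<bullet> (U\<^sup>T *\<^sub>v X f)"
      using U by (intro transpose_vec_mult_scalar[symmetric]) auto
    finally show "inner_on (verts G) f f = (\<Sum>i<n. (inner_on (verts G) (p i) f)\<^sup>2)"
      using U by (simp add: scalar_prod_def inner_on_p power2_eq_square atLeast0LessThan)
  next
    fix f
    define y where "y = U\<^sup>T *\<^sub>v X f"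
    have y: "y \<in> carrier_vec n" using U by (simp add: y_def)
    note form[of f]
    also have "?L *\<^sub>v X f = U *\<^sub>v (?D *\<^sub>v y)"
      using U unfolding y_def by (subst LD) (simp add: assoc_mult_mat_vec[of _ n n _ n])
    also have "?D *\<^sub>v y = vec n (\<lambda>i. d i * y $ i)"
    proof (rule eq_vecI)
      fix i assume "i < dim_vec (vec n (\<lambda>i. d i * y $ i))"
      then have i: "i < n" by simp
      then have "(?D *\<^sub>v y) $ i = (\<Sum>j<n. (if i = j then d i else 0) * y $ j)"
        using y by (simp add: scalar_prod_def atLeast0LessThan)
      also have "\<dots> = (\<Sum>j<n. if i = j then d i * y $ j else 0)"
        by (rule sum.cong) auto
      finally show "(?D *\<^sub>v y) $ i = vec n (\<lambda>i. d i * y $ i) $ i" using i by simp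
    qed simp
    also have "X f \<bullet> (U *\<^sub>v \<dots>) = y \<bullet> vec n (\<lambda>i. d i * y $ i)"
      unfolding y_def by (rule transpose_vec_mult_scalar[OF U, symmetric]) auto
    finally show "dirichlet_form G f = (\<Sum>i<n. d i * (inner_on (verts G) (p i) f)\<^sup>2)"
      by (simp add: scalar_prod_def inner_on_p y_def power2_eq_square atLeast0LessThan ac_simps)
  next
    fix i assume i: "i < n"
    \<comment> \<open>The diagonal entry is the Dirichlet form at \<open>p i\<close>, a sum of
      squares over edges.\<close>
    have "0 \<le> (U\<^sup>T * ?L * U) $$ (i, i)"
    proof -
      have "(U\<^sup>T * ?L * U) $$ (i, i) = X (p i) \<bullet> (?L *\<^sub>v X (p i))"
        using U L i by (simp add: assoc_mult_mat[of _ n n _ n _ n] Xp mult_mat_vec_def)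
      also have "\<dots> = dirichlet_form G (p i)" by (rule form[symmetric])
      finally show ?thesis using dirichlet_form_nonneg[OF G] by simp
    qed
    then show "0 \<le> d i" using i by (simp add: D)
  qed
  have "similar_mat ?L ?D"
    by (rule similar_matI[of _ _ U "U\<^sup>T" n]) (use U L UU UU' LD in auto)
  then have "char_poly ?L = char_poly ?D" by (rule char_poly_similar)
  also have "\<dots> = (\<Prod>a\<leftarrow>diag_mat ?D. [:- a, 1:])"
    by (rule char_poly_upper_triangular) (auto intro!: upper_triangularI)
  also have "diag_mat ?D = map d [0..<n]"
    by (auto simp: diag_mat_def)
  finally show thesis using that frame unfolding n_def by blast
qed

section \<open>From the characteristic polynomial to LEL\<close>

lemma proots_prod_linear_factors:
  fixes as :: "'b :: idom list"
  shows "proots (\<Prod>a\<leftarrow>as. [:- a, 1:]) = mset as"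
proof (induction as)
  case (Cons a as)
  have "(\<Prod>a\<leftarrow>as. [:- a, 1:]) \<noteq> 0" by (auto simp: prod_list_zero_iff)
  then have "proots ([:- a, 1:] * (\<Prod>a\<leftarrow>as. [:- a, 1:])) = {#a#} + mset as"
    by (subst proots_mult) (simp_all add: Cons.IH)
  then show ?case by simp
qed simp

text \<open>\<open>LEL\<close> leaves out the last eigenvalue. This loses nothing: the form vanishes
  on constants, so 0 is an eigenvalue, and it is the least one.\<close>

lemma LEL_eq_sum_sqrt:
  assumes G: "simple_graph G"
    and F: "spectral_frame (verts G) n p d (dirichlet_form G)" and n: "n = card (verts G)"
    and char_poly: "char_poly (laplacian G) = (\<Prod>a\<leftarrow>map d [0..<n]. [:- a, 1:])"
  shows "LEL G = (\<Sum>i<n. sqrt (d i))"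
proof (cases n)
  \<comment> \<open>Without vertices there is no eigenvalue 0, but truncated subtraction makes both
    sums empty.\<close>
  case 0
  then show ?thesis using n by (simp add: LEL_def)
next
  case (Suc m)
  define es where "es = laplacian_eigenvalues G"
  have "proots (char_poly (laplacian G)) = mset (map d [0..<n])"
    unfolding char_poly by (rule proots_prod_linear_factors)
  then have es: "es = rev (sort (map d [0..<n]))"
    by (simp only: es_def laplacian_eigenvalues_def sorted_list_of_multiset_mset)
  then have len: "length es = n" and mset_es: "mset es = mset (map d [0..<n])" by auto
  have ed: "set es = d ` {..<n}"
    using es by (auto simp: image_iff)
  \<comment> \<open>Were every \<open>d i\<close> nonzero, the constant function 1 would have all
    coordinates 0 in the frame, although its squared norm is the number of vertices.\<close>
  have "\<exists>i<n. d i = 0"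
  proof (rule ccontr)
    assume *: "\<not> ?thesis"
    have "dirichlet_form G (\<lambda>_. 1) = 0"
      unfolding dirichlet_form_def
      by (intro sum.neutral ballI) (auto elim!: simple_graph_edge[OF G] simp: edge_energy_pair)
    then have "\<forall>i\<in>{..<n}. d i * (inner_on (verts G) (p i) (\<lambda>_. 1))\<^sup>2 = 0"
      using spectral_frameD(2)[OF F]
      unfolding spectral_frameD(5)[OF F] by (subst (asm) sum_nonneg_eq_0_iff) auto
    with * have "inner_on (verts G) (\<lambda>_. 1) (\<lambda>_. 1) = 0"
      unfolding spectral_frameD(4)[OF F] by (intro sum.neutral) auto
    then show False using n Suc by (simp add: inner_on_def)
  qed
  then have "0 \<in> set es" using ed by force
  then obtain i where i: "i < n" "es ! i = 0" by (auto simp: in_set_conv_nth len)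
  have "sorted (rev es)" by (simp add: es)
  then have "es ! m \<le> es ! i"
    using i(1) Suc len by (intro sorted_rev_nth_mono) auto
  moreover have "0 \<le> es ! m"
    using ed spectral_frameD(2)[OF F] nth_mem[of m es] Suc len by auto
  ultimately have last: "es ! m = 0" using i(2) by simp
  have "(\<Sum>i<n. sqrt (d i)) = sum_list (map sqrt (map d [0..<n]))"
    by (simp add: interv_sum_list_conv_sum_set_nat o_def atLeast0LessThan)
  also have "\<dots> = sum_list (map sqrt es)"
    using mset_es by (metis mset_map sum_mset_sum_list)
  also have "\<dots> = (\<Sum>i<n. sqrt (es ! i))"
    by (simp add: sum_list_sum_nth len atLeast0LessThan)
  also have "\<dots> = LEL G"
    using last n[symmetric] Suc by (simp add: LEL_def flip: es_def)
  finally show ?thesis by simp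
qed

subsection \<open>Comparison of LEL for two graphs\<close>

text \<open>Take \<open>b\<close> to be 1 at one end and -1 at the other; squaring makes the choice
  of orientation irrelevant. The squared norm 2 is the source of the constant
  \<open>sqrt 2\<close>.\<close>

lemma edge_energy_eq_inner_on_squared:
  assumes "finite V" "e \<subseteq> V" "card e = 2"
  obtains b where "inner_on V b b = 2" "\<And>f. (inner_on V b f)\<^sup>2 = edge_energy e f"
proof -
  obtain u v where e: "e = {u, v}" "u \<noteq> v" using assms(3) by (auto simp: card_2_iff)
  define b where "b x = (if x = u then 1 else if x = v then -1 else 0 :: real)" for x
  have b: "inner_on V b f = f u - f v" for f
  proof -
    have "inner_on V b f = (\<Sum>x\<in>{u, v}. b x * f x)"
      unfolding inner_on_def using assms e
      by (intro sum.mono_neutral_right) (auto simp: b_def)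
    then show ?thesis using e by (simp add: b_def)
  qed
  have "inner_on V b b = 2" using e(2) by (simp add: b) (simp add: b_def)
  moreover have "(inner_on V b f)\<^sup>2 = edge_energy e f" for f using e by (simp add: b edge_energy_pair)
  ultimately show thesis by (rule that)
qed

theorem LEL_le_add_edges:
  assumes G: "simple_graph G" and H: "simple_graph H"
  shows "LEL G \<le> LEL H + sqrt 2 * real (card (edges G - edges H))"
proof -
  \<comment> \<open>The vertex sets may differ, so they are united as well; both given forms can
    then be handled on \<open>verts U\<close>.\<close>
  define U where "U = \<lparr>verts = verts G \<union> verts H, edges = edges G \<union> edges H\<rparr>"
  let ?D = "edges G - edges H"
  have U: "simple_graph U"
    using G H by (auto simp: U_def simple_graph_def)
  note fin = simple_graph_finite[OF G] simple_graph_finite[OF H] simple_graph_finite[OF U]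
  obtain p d where FG: "spectral_frame (verts G) (card (verts G)) p d (dirichlet_form G)"
    and "char_poly (laplacian G) = (\<Prod>a\<leftarrow>map d [0..<card (verts G)]. [:- a, 1:])"
    by (rule laplacian_spectral_frame[OF G])
  note LG = LEL_eq_sum_sqrt[OF G this(1) refl this(2)]
  obtain q s where FH: "spectral_frame (verts H) (card (verts H)) q s (dirichlet_form H)"
    and "char_poly (laplacian H) = (\<Prod>a\<leftarrow>map s [0..<card (verts H)]. [:- a, 1:])"
    by (rule laplacian_spectral_frame[OF H])
  note LH = LEL_eq_sum_sqrt[OF H this(1) refl this(2)]
  obtain r t where FU: "spectral_frame (verts U) (card (verts U)) r t (dirichlet_form U)"
    and "char_poly (laplacian U) = (\<Prod>a\<leftarrow>map t [0..<card (verts U)]. [:- a, 1:])"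
    by (rule laplacian_spectral_frame[OF U])
  note LU = LEL_eq_sum_sqrt[OF U this(1) refl this(2)]
  have "dirichlet_form G f \<le> dirichlet_form U f" for f
    unfolding dirichlet_form_def using fin edge_energy_nonneg[OF U]
    by (intro sum_mono2) (auto simp: U_def)
  then have "LEL G \<le> LEL U"
    unfolding LG LU by (intro spectral_frame_trace_sqrt_mono[OF FG FU]) (auto simp: U_def)
  also have "LEL U \<le> LEL H + sqrt 2 * real (card ?D)"
  proof -
    have "\<exists>b. inner_on (verts U) b b = 2 \<and> (\<forall>f. (inner_on (verts U) b f)\<^sup>2 = edge_energy e f)" if "e \<in> ?D" for e
    proof -
      have "e \<subseteq> verts U" "card e = 2"
        using G that by (auto simp: simple_graph_def U_def)
      with fin(5) show ?thesis by (metis edge_energy_eq_inner_on_squared)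
    qed
    then obtain b where b: "inner_on (verts U) (b e) (b e) = 2"
      "(inner_on (verts U) (b e) f)\<^sup>2 = edge_energy e f" if "e \<in> ?D" for e f
      by metis
    \<comment> \<open>The squares of these functionals add up to the form of \<open>H\<close>, and
      their norms \<open>sqrt (s i)\<close> add up to exactly \<open>LEL H\<close>. The spectral
      decomposition of \<open>H\<close> replaces its edges, each of which would cost
      \<open>sqrt 2\<close>.\<close>
    define a where "a i v = (if v \<in> verts H then sqrt (s i) * q i v else 0)" for i v
    have a: "inner_on (verts U) (a i) f = sqrt (s i) * inner_on (verts H) (q i) f" for i f
    proof -
      have "inner_on (verts U) (a i) f = (\<Sum>v\<in>verts H. sqrt (s i) * (q i v * f v))"
        unfolding inner_on_def using fin by (intro sum.mono_neutral_cong_right) (auto simp: a_def U_def)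
      then show ?thesis by (simp add: inner_on_def sum_distrib_left)
    qed
    have aa: "sqrt (inner_on (verts U) (a i) (a i)) = sqrt (s i)" if i: "i < card (verts H)" for i
    proof -
      have "inner_on (verts H) (q i) (a i) = inner_on (verts H) (q i) (\<lambda>v. sqrt (s i) * q i v)"
        by (simp add: inner_on_def a_def)
      then show ?thesis
        using spectral_frameD(2,3)[OF FH i] i by (simp add: a inner_on_scale_right)
    qed
    \<comment> \<open>One family indexed by a disjoint sum: eigenvectors of \<open>H\<close> on the
      left, additional edges on the right.\<close>
    let ?K = "{..<card (verts H)} <+> ?D"
    have "LEL U \<le> (\<Sum>k\<in>?K. sqrt (inner_on (verts U) (case_sum a b k) (case_sum a b k)))"
      unfolding LU
    proof (rule spectral_frame_trace_sqrt_le[OF FU])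
      show "finite ?K" using fin by simp
      fix f
      have "dirichlet_form U f = dirichlet_form H f + (\<Sum>e\<in>?D. edge_energy e f)"
        unfolding dirichlet_form_def using fin
        by (subst sum.union_disjoint[symmetric]) (auto simp: U_def intro!: sum.cong)
      also have "dirichlet_form H f = (\<Sum>i<card (verts H). (inner_on (verts U) (a i) f)\<^sup>2)"
        unfolding spectral_frameD(5)[OF FH] using spectral_frameD(2)[OF FH]
        by (intro sum.cong) (auto simp: a power_mult_distrib)
      also have "(\<Sum>e\<in>?D. edge_energy e f) = (\<Sum>e\<in>?D. (inner_on (verts U) (b e) f)\<^sup>2)"
        by (simp add: b(2))
      finally show "dirichlet_form U f = (\<Sum>k\<in>?K. (inner_on (verts U) (case_sum a b k) f)\<^sup>2)"
        using fin by (simp add: sum.Plus)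
    qed
    also have "\<dots> = (\<Sum>i<card (verts H). sqrt (s i)) + (\<Sum>e\<in>?D. sqrt 2)"
      using fin by (simp add: sum.Plus aa b(1))
    finally show ?thesis by (simp add: LH mult.commute)
  qed
  finally show ?thesis .
qed

section \<open>The two-sided estimate and the limit\<close>

lemma LEL_nonneg:
  assumes G: "simple_graph G"
  shows "0 \<le> LEL G"
proof -
  obtain p d where F: "spectral_frame (verts G) (card (verts G)) p d (dirichlet_form G)"
    and "char_poly (laplacian G) = (\<Prod>a\<leftarrow>map d [0..<card (verts G)]. [:- a, 1:])"
    by (rule laplacian_spectral_frame[OF G])
  from LEL_eq_sum_sqrt[OF G this(1) refl this(2)] show ?thesis
    using spectral_frameD(2)[OF F] by (auto intro!: sum_nonneg)
qed

lemma edge_diff_eq: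
  assumes "simple_graph G" "simple_graph H"
  shows "edge_diff G H = int (card (edges G - edges H)) + int (card (edges H - edges G))"
proof -
  note fin = simple_graph_finite(2)[OF assms(1)] simple_graph_finite(2)[OF assms(2)]
  have "card (edges G) = card (edges G \<inter> edges H) + card (edges G - edges H)"
    "card (edges H) = card (edges H \<inter> edges G) + card (edges H - edges G)"
    using card_Int_Diff[OF fin(1)] card_Int_Diff[OF fin(2)] by auto
  then show ?thesis by (simp add: edge_diff_def Int_commute)
qed

text \<open>Apply the one-sided estimate in both directions; each direction counts one half of the
  symmetric difference.\<close>

theorem LEL_diff_le_edge_diff:
  assumes "simple_graph G" "simple_graph H"
  shows "\<bar>LEL H - LEL G\<bar> \<le> sqrt 2 * real_of_int (edge_diff G H)"
proof -
  have "LEL G - LEL H \<le> sqrt 2 * real (card (edges G - edges H))"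
    "LEL H - LEL G \<le> sqrt 2 * real (card (edges H - edges G))"
    using LEL_le_add_edges[OF assms] LEL_le_add_edges[OF assms(2,1)] by auto
  moreover have "0 \<le> sqrt 2 * real (card (edges G - edges H))"
    "0 \<le> sqrt 2 * real (card (edges H - edges G))" by auto
  ultimately show ?thesis
    unfolding edge_diff_eq[OF assms] of_int_add of_int_of_nat_eq distrib_left by linarith
qed

theorem theorem3p5:
  fixes G H :: "nat \<Rightarrow> 'a graph"
  assumes "\<And>n. simple_graph (G n)"
    and "\<And>n. simple_graph (H n)"
    and "\<And>n. LEL (G n) \<noteq> 0"
    and "(\<lambda>n. real_of_int (edge_diff (G n) (H n)) / LEL (G n)) \<longlonglongrightarrow> 0"
  shows "(\<lambda>n. LEL (H n) / LEL (G n)) \<longlonglongrightarrow> 1"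
proof -
  let ?e = "\<lambda>n. real_of_int (edge_diff (G n) (H n)) / LEL (G n)"
  \<comment> \<open>Positivity lets the estimate be divided by \<open>LEL (G n)\<close>, so that the
    error of the ratio is at most \<open>sqrt 2\<close> times a null sequence.\<close>
  have pos: "0 < LEL (G n)" for n
    using LEL_nonneg[OF assms(1)] assms(3) by (simp add: less_le)
  have "norm (LEL (H n) / LEL (G n) - 1) \<le> norm (?e n) * sqrt 2" for n
  proof -
    have "LEL (H n) / LEL (G n) - 1 = (LEL (H n) - LEL (G n)) / LEL (G n)"
      using pos[of n] by (simp add: diff_divide_distrib)
    then have "norm (LEL (H n) / LEL (G n) - 1) = \<bar>LEL (H n) - LEL (G n)\<bar> / LEL (G n)"
      using pos[of n] by simp
    also have "\<dots> \<le> sqrt 2 * real_of_int (edge_diff (G n) (H n)) / LEL (G n)"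
      using LEL_diff_le_edge_diff[OF assms(1,2)] pos[of n] by (intro divide_right_mono) auto
    also have "\<dots> = ?e n * sqrt 2" by simp
    also have "\<dots> \<le> norm (?e n) * sqrt 2"
      unfolding real_norm_def by (intro mult_right_mono abs_ge_self) simp
    finally show ?thesis .
  qed
  then have "(\<lambda>n. LEL (H n) / LEL (G n) - 1) \<longlonglongrightarrow> 0"
    by (intro tendsto_0_le[OF assms(4), of _ "sqrt 2"] always_eventually allI)
  then show ?thesis by (simp add: LIM_zero_iff)
qed

end
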